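(* Let $m,n\ge2$ be integers and consider the $m\times n$ splitting tic-tac-toe game. (i) If $m=n=3$, then the player who moves second (Player II) has a winning strategy, whether that player is Split or Skew. (ii) Otherwise, Skew has a winning strategy, regardless of which player moves first.
   Context: For $A,B$ subsets of a finite set $X$, $A$ splits $B$ if $|A\cap B|=|B|/2$ when $|B|$ is even, and $|A\cap B|\in\{(|B|-1)/2,(|B|+1)/2\}$ when $|B|$ is odd. The $m\times n$ splitting tic-tac-toe game is played on the set $X$ of the $mn$ cells of an $m\times n$ grid, with $\mathcal B$ the family consisting of all $m$ rows and all $n$ columns of the grid (each viewed as a set of cells). Players Split and Skew alternately claim an unclaimed cell, until all cells have been claimed; either player may be designated to move first. Split wins if the set of cells Split claimed splits every set in $\mathcal B$; otherwise Skew wins. *)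

theory Defs
  imports Main
begin

definition splits :: "'a set \<Rightarrow> 'a set \<Rightarrow> bool" where
  "splits A B \<longleftrightarrow>
     (if even (card B) then card (A \<inter> B) = card B div 2
      else card (A \<inter> B) \<in> {(card B - 1) div 2, (card B + 1) div 2})"

datatype player = Split | Skew

fun opponent :: "player \<Rightarrow> player" where
  "opponent Split = Skew"
| "opponent Skew = Split"

text \<open>
  A history of the game on the board \<open>X\<close> is the list of claimed cells in the order in which
  they were claimed; \<open>P1\<close> is the player who moves first.
\<close>

definition mover :: "player \<Rightarrow> nat \<Rightarrow> player" where
  "mover P1 k = (if even k then P1 else opponent P1)"

definition histories :: "'a set \<Rightarrow> 'a list set" where
  "histories X = {h. distinct h \<and> set h \<subseteq> X}"

definition complete_plays :: "'a set \<Rightarrow> 'a list set" where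
  "complete_plays X = {h. distinct h \<and> set h = X}"

definition claimed :: "player \<Rightarrow> player \<Rightarrow> 'a list \<Rightarrow> 'a set" where
  "claimed P1 P h = {h ! k | k. k < length h \<and> mover P1 k = P}"

definition winner :: "'a set set \<Rightarrow> player \<Rightarrow> 'a list \<Rightarrow> player" where
  "winner \<B> P1 h = (if \<forall>B\<in>\<B>. splits (claimed P1 Split h) B then Split else Skew)"

text \<open>
  A strategy maps the history so far to the next cell; it must prescribe an unclaimed cell
  whenever it is the player's turn and the board is not yet full.
\<close>

definition is_strategy :: "'a set \<Rightarrow> player \<Rightarrow> player \<Rightarrow> ('a list \<Rightarrow> 'a) \<Rightarrow> bool" where
  "is_strategy X P1 P \<sigma> \<longleftrightarrow>
     (\<forall>h \<in> histories X. set h \<noteq> X \<and> mover P1 (length h) = P \<longrightarrow> \<sigma> h \<in> X - set h)"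

definition follows :: "player \<Rightarrow> player \<Rightarrow> ('a list \<Rightarrow> 'a) \<Rightarrow> 'a list \<Rightarrow> bool" where
  "follows P1 P \<sigma> h \<longleftrightarrow> (\<forall>k < length h. mover P1 k = P \<longrightarrow> h ! k = \<sigma> (take k h))"

definition has_winning_strategy :: "'a set \<Rightarrow> 'a set set \<Rightarrow> player \<Rightarrow> player \<Rightarrow> bool" where
  "has_winning_strategy X \<B> P1 P \<longleftrightarrow>
     (\<exists>\<sigma>. is_strategy X P1 P \<sigma> \<and>
          (\<forall>h \<in> complete_plays X. follows P1 P \<sigma> h \<longrightarrow> winner \<B> P1 h = P))"

definition grid :: "nat \<Rightarrow> nat \<Rightarrow> (nat \<times> nat) set" where
  "grid m n = {..<m} \<times> {..<n}"

definition grid_lines :: "nat \<Rightarrow> nat \<Rightarrow> (nat \<times> nat) set set" where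
  "grid_lines m n = {{i} \<times> {..<n} | i. i < m} \<union> {{..<m} \<times> {j} | j. j < n}"

end

theory Submission
  imports Defs
begin

text \<open>
  Call the excess of a line the number of Skew's cells on it minus the number of Split's.
  Everything Skew needs follows from two facts about a single line \<open>L\<close>, with threshold 1 if
  \<open>|L|\<close> is even and 2 if it is odd. If Skew is to move and the excess has reached the threshold, Skew
  keeps playing in \<open>L\<close> and the excess never falls below it again (\<open>lead_wins\<close>); so a move
  of Skew that brings the excess of \<open>L\<close> up to the threshold forces an answer in \<open>L\<close>
  (\<open>forcing_move\<close>). If moreover an even number of cells is free, so that Split makes the last
  move, then an excess of minus the threshold wins as well: Skew keeps away from \<open>L\<close>
  (\<open>deficit_wins\<close>).

  If the rows have even length, each of Skew's moves in a chosen column forces an answer in its row,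
  hence outside the column, and Skew obtains the whole column (\<open>fill_column\<close>). Columns of even
  length are the transposed case.

  Let both sides be odd. If Split moves first, Skew answers outside the row and the column of that
  first cell. Then Skew's row crosses the column of Split's cell, and Skew's column crosses its row;
  Split's next move leaves one of these crossings between a line of positive and a line of negative
  excess free. Skew fills the positive line without using the crossing, so in the end Split has to take
  it, and the negative line falls to \<open>-2\<close> (\<open>crossing_lead_and_deficit_win\<close>). This
  includes the 3 by 3 grid. If Skew moves first and the grid is larger, forced answers produce two rows of
  positive excess with a free common column, and a double threat there decides the game
  (\<open>parallel_leads_win\<close>, \<open>odd_first_wins\<close>).

  There remains the 3 by 3 grid with Skew moving first, where Split wins. This is a finite check: an
  exhaustive search through the game tree is proved sound (\<open>can_answer_sound\<close>) and evaluated.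
\<close>

section \<open>Winning positions and winning strategies\<close>

text \<open>
  Positions from which one player can force \<open>G\<close> at the end, where \<open>A\<close> holds the cells of
  that player and \<open>B\<close> those of the opponent; the two predicates say whose turn it is. Playing
  on positions instead of histories is possible because the winner depends only on the final sets.
\<close>

inductive wins_to_move :: "'a set \<Rightarrow> ('a set \<Rightarrow> 'a set \<Rightarrow> bool) \<Rightarrow> 'a set \<Rightarrow> 'a set \<Rightarrow> bool"
  and wins_to_wait :: "'a set \<Rightarrow> ('a set \<Rightarrow> 'a set \<Rightarrow> bool) \<Rightarrow> 'a set \<Rightarrow> 'a set \<Rightarrow> bool"
  for X :: "'a set" and G :: "'a set \<Rightarrow> 'a set \<Rightarrow> bool"
where
  full_to_move: "\<lbrakk>X \<subseteq> A \<union> B; G A B\<rbrakk> \<Longrightarrow> wins_to_move X G A B"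
| move: "\<lbrakk>x \<in> X - (A \<union> B); wins_to_wait X G (insert x A) B\<rbrakk> \<Longrightarrow> wins_to_move X G A B"
| full_to_wait: "\<lbrakk>X \<subseteq> A \<union> B; G A B\<rbrakk> \<Longrightarrow> wins_to_wait X G A B"
| wait: "\<lbrakk>\<not> X \<subseteq> A \<union> B; \<And>x. x \<in> X - (A \<union> B) \<Longrightarrow> wins_to_move X G A (insert x B)\<rbrakk>
    \<Longrightarrow> wins_to_wait X G A B"

lemma mover_cases: "mover P1 k \<noteq> P \<longleftrightarrow> mover P1 k = opponent P"
  by (cases P; cases P1) (auto simp: mover_def)

lemma opponent_neq: "opponent P \<noteq> P"
  by (cases P) auto

lemma mover_Suc: "mover P1 (Suc k) = opponent (mover P1 k)"
  by (cases P1) (auto simp: mover_def)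

lemma opponent_opponent: "opponent (opponent P) = P"
  by (cases P) auto

lemma claimed_image: "claimed P1 P h = (!) h ` {k. k < length h \<and> mover P1 k = P}"
  unfolding claimed_def by blast

lemma claimed_snoc:
  "claimed P1 P (h @ [x]) =
     (if mover P1 (length h) = P then insert x (claimed P1 P h) else claimed P1 P h)"
proof -
  let ?K = "{k. k < length h \<and> mover P1 k = P}"
  have "{k. k < length (h @ [x]) \<and> mover P1 k = P} =
      ?K \<union> (if mover P1 (length h) = P then {length h} else {})"
    by (auto simp: less_Suc_eq)
  moreover have "(!) (h @ [x]) ` ?K = (!) h ` ?K"
    by (intro image_cong) (auto simp: nth_append)
  ultimately show ?thesis by (simp add: claimed_image image_Un)
qed

lemma claimed_union: "claimed P1 P h \<union> claimed P1 (opponent P) h = set h"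
proof -
  have "{k. k < length h \<and> mover P1 k = P} \<union> {k. k < length h \<and> mover P1 k = opponent P} =
      {..<length h}"
    using mover_cases[of P1 _ P] by blast
  then have "claimed P1 P h \<union> claimed P1 (opponent P) h = (!) h ` {..<length h}"
    by (simp add: claimed_image flip: image_Un)
  then show ?thesis by (auto simp: in_set_conv_nth)
qed

text \<open>
  The strategy moves to a winning waiting position whenever there is one, and to an arbitrary free cell
  otherwise; the latter keeps it legal on histories that it would never produce itself. Along a play
  that follows it the position stays winning, so \<open>G\<close> holds when the board is full.
\<close>

lemma has_winning_strategyI:
  assumes start: "if P1 = P then wins_to_move X G {} {} else wins_to_wait X G {} {}"
    and goal: "\<And>h. \<lbrakk>h \<in> complete_plays X; G (claimed P1 P h) (claimed P1 (opponent P) h)\<rbrakk>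
      \<Longrightarrow> winner \<B> P1 h = P"
  shows "has_winning_strategy X \<B> P1 P"
proof -
  define good where "good h x \<longleftrightarrow> x \<in> X - set h \<and>
    wins_to_wait X G (insert x (claimed P1 P h)) (claimed P1 (opponent P) h)" for h x
  define \<sigma> where "\<sigma> h = (if \<exists>x. good h x then SOME x. good h x else SOME x. x \<in> X - set h)" for h
  have good: "good h (\<sigma> h)" if "\<exists>x. good h x" for h
    using that by (simp add: \<sigma>_def someI_ex)
  have legal: "\<sigma> h \<in> X - set h" if "h \<in> histories X" "set h \<noteq> X" for h
  proof (cases "\<exists>x. good h x")
    case True
    then show ?thesis using good good_def by blast
  next
    case False
    from that have "\<exists>x. x \<in> X - set h" by (auto simp: histories_def)
    then have "(SOME x. x \<in> X - set h) \<in> X - set h" by (rule someI_ex)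
    with False show ?thesis unfolding \<sigma>_def by (simp only: if_False)
  qed
  have "winner \<B> P1 h = P" if h: "h \<in> complete_plays X" and f: "follows P1 P \<sigma> h" for h
  proof -
    let ?A = "\<lambda>k. claimed P1 P (take k h)" and ?B = "\<lambda>k. claimed P1 (opponent P) (take k h)"
    have AB: "?A k \<union> ?B k = set (take k h)" for k by (rule claimed_union)
    have inv: "if mover P1 k = P then wins_to_move X G (?A k) (?B k) else wins_to_wait X G (?A k) (?B k)"
      if "k \<le> length h" for k
      using that
    proof (induction k)
      case 0
      show ?case using start by (auto simp: mover_def claimed_def)
    next
      case (Suc k)
      let ?x = "h ! k"
      have t: "take (Suc k) h = take k h @ [?x]" and len: "length (take k h) = k"
        using Suc.prems by (auto simp: take_Suc_conv_app_nth)
      have x: "?x \<in> X - set (take k h)"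
      proof -
        have "distinct (take (Suc k) h)" using h by (simp add: complete_plays_def)
        then have "?x \<notin> set (take k h)" unfolding t by simp
        moreover have "?x \<in> X" using h Suc.prems by (auto simp: complete_plays_def)
        ultimately show ?thesis by simp
      qed
      show ?case
      proof (cases "mover P1 k = P")
        case True
        then have "wins_to_move X G (?A k) (?B k)" using Suc by simp
        then have "\<exists>y. good (take k h) y"
          using x AB[of k] unfolding good_def by cases auto
        then have "good (take k h) ?x"
          using good f True Suc.prems by (auto simp: follows_def)
        moreover have "mover P1 (Suc k) \<noteq> P" using True opponent_neq by (simp add: mover_Suc)
        ultimately show ?thesis
          unfolding t claimed_snoc len good_def using True opponent_neq[of P] by simp
      next
        case False
        then have "wins_to_wait X G (?A k) (?B k)" using Suc by simp
        then have "wins_to_move X G (?A k) (insert ?x (?B k))"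
          using x AB[of k] by cases auto
        moreover have "mover P1 (Suc k) = P" "mover P1 k = opponent P"
          using False mover_cases[of P1 k P] by (auto simp: mover_Suc opponent_opponent)
        ultimately show ?thesis
          unfolding t claimed_snoc len using opponent_neq[of P] by simp
      qed
    qed
    have "X \<subseteq> claimed P1 P h \<union> claimed P1 (opponent P) h"
      using h claimed_union[of P1 P h] by (simp add: complete_plays_def)
    then have "G (claimed P1 P h) (claimed P1 (opponent P) h)"
      using inv[of "length h"]
      by (auto split: if_splits elim: wins_to_move.cases wins_to_wait.cases)
    then show ?thesis using goal h by blast
  qed
  then show ?thesis unfolding has_winning_strategy_def is_strategy_def using legal by blast
qed

text \<open>
  Relabelling the cells carries winning positions over; this is what makes the two sides of the grid
  interchangeable.
\<close>

lemma wins_image: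
  assumes f: "inj_on f X"
    and G: "\<And>A B. \<lbrakk>A \<subseteq> X; B \<subseteq> X; G A B\<rbrakk> \<Longrightarrow> G' (f ` A) (f ` B)"
  shows "wins_to_move X G A B \<Longrightarrow> A \<subseteq> X \<Longrightarrow> B \<subseteq> X \<Longrightarrow> wins_to_move (f ` X) G' (f ` A) (f ` B)"
    and "wins_to_wait X G A B \<Longrightarrow> A \<subseteq> X \<Longrightarrow> B \<subseteq> X \<Longrightarrow> wins_to_wait (f ` X) G' (f ` A) (f ` B)"
proof (induction rule: wins_to_move_wins_to_wait.inducts)
  case (full_to_move A B)
  then show ?case by (intro wins_to_move_wins_to_wait.full_to_move G) auto
next
  case (move x A B)
  then have "f x \<in> f ` X - (f ` A \<union> f ` B)" using f by (auto simp: inj_on_def)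
  then show ?case using move by (auto intro: wins_to_move_wins_to_wait.move)
next
  case (full_to_wait A B)
  then show ?case by (intro wins_to_move_wins_to_wait.full_to_wait G) auto
next
  case (wait A B)
  show ?case
  proof (rule wins_to_move_wins_to_wait.wait)
    obtain x where "x \<in> X" "x \<notin> A \<union> B" using wait by blast
    then have "f x \<in> f ` X" "f x \<notin> f ` A \<union> f ` B"
      using f wait.prems by (auto simp: inj_on_def)
    then show "\<not> f ` X \<subseteq> f ` A \<union> f ` B" by blast
  next
    fix y assume "y \<in> f ` X - (f ` A \<union> f ` B)"
    then obtain x where "x \<in> X - (A \<union> B)" "y = f x" by auto
    then show "wins_to_move (f ` X) G' (f ` A) (insert y (f ` B))"
      using wait.IH wait.prems by simp
  qed
qed


section \<open>Play on a single line\<close>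

text \<open>
  In all that concerns Skew, \<open>A\<close> is the set of Skew's cells and \<open>B\<close> that of Split's.
\<close>

definition excess :: "'a set \<Rightarrow> 'a set \<Rightarrow> 'a set \<Rightarrow> int" where
  "excess A B L = int (card (A \<inter> L)) - int (card (B \<inter> L))"

lemma excess_empty [simp]: "excess {} {} L = 0"
  by (simp add: excess_def)

lemma excess_insert_left:
  "finite A \<Longrightarrow> x \<notin> A \<Longrightarrow> excess (insert x A) B L = excess A B L + (if x \<in> L then 1 else 0)"
  by (simp add: excess_def)

lemma excess_insert_right:
  "finite B \<Longrightarrow> x \<notin> B \<Longrightarrow> excess A (insert x B) L = excess A B L - (if x \<in> L then 1 else 0)"
  by (simp add: excess_def)

lemmas excess_insert = excess_insert_left excess_insert_right

abbreviation skewed :: "'a set set \<Rightarrow> 'a set \<Rightarrow> 'a set \<Rightarrow> bool" where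
  "skewed \<B> A B \<equiv> \<exists>L\<in>\<B>. \<not> splits B L"

locale line_game =
  fixes X :: "'a set" and \<B> :: "'a set set"
  assumes finite_X: "finite X" and lines_subset: "L \<in> \<B> \<Longrightarrow> L \<subseteq> X"
begin

abbreviation to_move :: "'a set \<Rightarrow> 'a set \<Rightarrow> bool" where
  "to_move \<equiv> wins_to_move X (skewed \<B>)"

abbreviation to_wait :: "'a set \<Rightarrow> 'a set \<Rightarrow> bool" where
  "to_wait \<equiv> wins_to_wait X (skewed \<B>)"

definition position :: "'a set \<Rightarrow> 'a set \<Rightarrow> bool" where
  "position A B \<longleftrightarrow> A \<subseteq> X \<and> B \<subseteq> X \<and> A \<inter> B = {}"

definition free :: "'a set \<Rightarrow> 'a set \<Rightarrow> 'a set" where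
  "free A B = X - (A \<union> B)"

lemma position_empty: "position {} {}"
  by (simp add: position_def)

lemma position_insert:
  assumes "position A B" "x \<in> free A B"
  shows "position (insert x A) B" "position A (insert x B)"
  using assms by (auto simp: position_def free_def)

lemma position_finite:
  assumes "position A B" shows "finite A" "finite B"
  using assms finite_X finite_subset by (auto simp: position_def)

lemma finite_free: "finite (free A B)"
  using finite_X by (simp add: free_def)

lemma free_insert:
  "free (insert x A) B = free A B - {x}" "free A (insert x B) = free A B - {x}"
  by (auto simp: free_def)

lemma excess_left:
  assumes "position A B" "x \<in> free A B"
  shows "excess (insert x A) B L = excess A B L + (if x \<in> L then 1 else 0)"
  using assms position_finite by (intro excess_insert) (auto simp: free_def)

lemma excess_right:
  assumes "position A B" "x \<in> free A B"
  shows "excess A (insert x B) L = excess A B L - (if x \<in> L then 1 else 0)"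
  using assms position_finite by (intro excess_insert) (auto simp: free_def)

lemma card_line:
  assumes "position A B" "L \<in> \<B>"
  shows "card L = card (A \<inter> L) + card (B \<inter> L) + card (L \<inter> free A B)"
proof -
  have "L = (A \<inter> L) \<union> (B \<inter> L) \<union> (L \<inter> free A B)"
    using lines_subset[OF assms(2)] by (auto simp: free_def)
  moreover have "finite (L \<inter> free A B)" using finite_free by simp
  ultimately show ?thesis
    using position_finite[OF assms(1)] assms(1)
    by (subst \<open>L = _\<close>, subst card_Un_disjoint, (auto simp: free_def position_def)[3],
        subst card_Un_disjoint) (auto simp: position_def)
qed

lemma even_free_iff:
  assumes "position A B" "L \<in> \<B>"
  shows "even (card (L \<inter> free A B)) \<longleftrightarrow> even (int (card L) - excess A B L)"
  using card_line[OF assms] by (auto simp: excess_def)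

text \<open>
  On a full board the two counts add up to \<open>|L|\<close>, so \<open>L\<close> is split exactly when they
  differ by \<open>|L| mod 2\<close>.
\<close>

lemma unbalanced_line:
  assumes "position A B" "L \<in> \<B>" "free A B = {}" "1 + int (card L mod 2) \<le> \<bar>excess A B L\<bar>"
  shows "\<exists>L\<in>\<B>. \<not> splits B L"
proof -
  have c: "card L = card (A \<inter> L) + card (B \<inter> L)" using card_line assms by simp
  have d: "1 + int (card L mod 2) \<le> \<bar>int (card (A \<inter> L)) - int (card (B \<inter> L))\<bar>"
    using assms(4) by (simp add: excess_def)
  have "\<not> splits B L"
  proof (cases "even (card L)")
    case True
    then obtain k where k: "card L = 2 * k" by (rule evenE)
    then have "card (B \<inter> L) \<noteq> k" using c d by auto
    then show ?thesis using k by (simp add: splits_def)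
  next
    case False
    then obtain k where k: "card L = 2 * k + 1" by (rule oddE)
    then have "card (B \<inter> L) \<noteq> k" "card (B \<inter> L) \<noteq> k + 1" using c d by auto
    then show ?thesis using k by (simp add: splits_def)
  qed
  then show ?thesis using assms(2) by blast
qed

lemma full_wins:
  assumes "position A B" "L \<in> \<B>" "free A B = {}" "1 + int (card L mod 2) \<le> \<bar>excess A B L\<bar>"
  shows "to_move A B" "to_wait A B"
  using unbalanced_line[OF assms] assms(3) by (auto simp: free_def intro: full_to_move full_to_wait)

text \<open>
  One move of Skew and the answer. When Skew takes the last cell there is no answer, and the full
  board has to be judged directly.
\<close>

lemma round_wins:
  assumes x: "x \<in> free A B"
    and last: "free A B = {x} \<Longrightarrow> to_wait (insert x A) B"
    and reply: "\<And>y. y \<in> free A B - {x} \<Longrightarrow> to_move (insert x A) (insert y B)"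
  shows "to_move A B"
proof -
  have "to_wait (insert x A) B"
  proof (cases "free A B = {x}")
    case False
    then show ?thesis using x
      by (intro wait reply) (auto simp: free_def)
  qed (rule last)
  then show ?thesis using x by (intro move) (auto simp: free_def)
qed

text \<open>
  Skew plays in \<open>L\<close> as long as there is room. Each such move raises the excess by one and the
  answer lowers it by at most one; once \<open>L\<close> is full its excess is final.
\<close>

lemma lead_wins:
  assumes "position A B" "L \<in> \<B>" "1 + int (card L mod 2) \<le> excess A B L"
  shows "to_move A B"
  using assms
proof (induction "card (free A B)" arbitrary: A B rule: less_induct)
  case less
  show ?case
  proof (cases "free A B = {}")
    case True
    then show ?thesis using full_wins less.prems by force
  next
    case False
    then obtain x where x: "x \<in> free A B" "x \<in> L \<or> L \<inter> free A B = {}" by blast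
    note pos = position_insert(1)[OF less.prems(1) x(1)]
    show ?thesis
    proof (rule round_wins[OF x(1)])
      assume "free A B = {x}"
      then show "to_wait (insert x A) B"
        using full_wins(2)[OF pos less.prems(2)] less.prems excess_left[OF less.prems(1) x(1)]
        by (auto simp: free_insert)
    next
      fix y assume y: "y \<in> free A B - {x}"
      then have yf: "y \<in> free (insert x A) B" by (simp add: free_insert)
      show "to_move (insert x A) (insert y B)"
      proof (rule less.hyps[OF _ position_insert(2)[OF pos yf] less.prems(2)])
        show "card (free (insert x A) (insert y B)) < card (free A B)"
          using x(1) y by (intro psubset_card_mono finite_free) (auto simp: free_insert)
        show "1 + int (card L mod 2) \<le> excess (insert x A) (insert y B) L"
          using less.prems(3) x y excess_left[OF less.prems(1) x(1), of L] excess_right[OF pos yf, of L]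
          by auto
      qed
    qed
  qed
qed

text \<open>
  After the move the excess of \<open>L\<close> has reached the threshold. If Split plays elsewhere, it is
  still there when Skew is to move, and \<open>lead_wins\<close> applies.
\<close>

lemma forcing_move:
  assumes pos: "position A B" and L: "L \<in> \<B>" "int (card L mod 2) \<le> excess A B L"
    and x: "x \<in> free A B" "x \<in> L"
    and reply: "\<And>y. \<lbrakk>y \<in> free A B; y \<noteq> x; y \<in> L\<rbrakk> \<Longrightarrow> to_move (insert x A) (insert y B)"
  shows "to_move A B"
proof -
  note pos' = position_insert(1)[OF pos x(1)]
  have lead: "1 + int (card L mod 2) \<le> excess (insert x A) B L"
    using L(2) x excess_left[OF pos x(1), of L] by simp
  show ?thesis
  proof (rule round_wins[OF x(1)])
    assume "free A B = {x}"
    then show "to_wait (insert x A) B"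
      using full_wins(2)[OF pos' L(1)] lead by (auto simp: free_insert)
  next
    fix y assume y: "y \<in> free A B - {x}"
    then have yf: "y \<in> free (insert x A) B" by (simp add: free_insert)
    show "to_move (insert x A) (insert y B)"
    proof (cases "y \<in> L")
      case True
      then show ?thesis using reply y by blast
    next
      case False
      then show ?thesis
        using lead_wins[OF position_insert(2)[OF pos' yf] L(1)] lead excess_right[OF pos' yf, of L]
        by simp
    qed
  qed
qed

text \<open>
  Skew plays outside \<open>L\<close> as long as possible, which never raises the excess. Once only cells of
  \<open>L\<close> are free, the number of free cells is still even, so both players get equally many of them and
  the excess stays as it is.
\<close>

lemma deficit_wins:
  assumes "position A B" "even (card (free A B))" "L \<in> \<B>" "excess A B L \<le> - 1 - int (card L mod 2)"
  shows "to_move A B"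
  using assms
proof (induction "card (free A B)" arbitrary: A B rule: less_induct)
  case less
  show ?case
  proof (cases "free A B = {}")
    case True
    then show ?thesis using full_wins less.prems by force
  next
    case False
    then obtain x where x: "x \<in> free A B" "x \<notin> L \<or> free A B \<subseteq> L" by blast
    note pos = position_insert(1)[OF less.prems(1) x(1)]
    show ?thesis
    proof (rule round_wins[OF x(1)])
      assume "free A B = {x}"
      then show "to_wait (insert x A) B" using less.prems(2) by simp
    next
      fix y assume y: "y \<in> free A B - {x}"
      then have yf: "y \<in> free (insert x A) B" by (simp add: free_insert)
      have card: "card (free (insert x A) (insert y B)) = card (free A B) - 2"
        using x(1) y by (simp add: free_insert finite_free)
      show "to_move (insert x A) (insert y B)"
      proof (rule less.hyps[OF _ position_insert(2)[OF pos yf] _ less.prems(3)])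
        show "card (free (insert x A) (insert y B)) < card (free A B)"
          using x(1) y by (intro psubset_card_mono finite_free) (auto simp: free_insert)
        show "even (card (free (insert x A) (insert y B)))"
          unfolding card using less.prems(2) by simp
        show "excess (insert x A) (insert y B) L \<le> - 1 - int (card L mod 2)"
          using less.prems(4) x y excess_left[OF less.prems(1) x(1), of L] excess_right[OF pos yf, of L]
          by auto
      qed
    qed
  qed
qed


section \<open>Crossing lines of odd length\<close>

text \<open>
  Taking the crossing threatens both lines at once, and one answer cannot meet both threats because the only
  cell the lines share is gone.
\<close>

lemma crossing_leads_win:
  assumes pos: "position A B"
    and L: "L \<in> \<B>" "odd (card L)" "1 \<le> excess A B L"
    and M: "M \<in> \<B>" "odd (card M)" "1 \<le> excess A B M"
    and z: "z \<in> free A B" "L \<inter> M = {z}"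
  shows "to_move A B"
proof (rule forcing_move[OF pos L(1) _ z(1)])
  show "int (card L mod 2) \<le> excess A B L" using L by (auto simp: odd_iff_mod_2_eq_one)
  show "z \<in> L" using z by blast
  fix y assume y: "y \<in> free A B" "y \<noteq> z" "y \<in> L"
  then have "y \<notin> M" using z by blast
  have yf: "y \<in> free (insert z A) B" using y by (simp add: free_insert)
  note pos' = position_insert(1)[OF pos z(1)]
  have "z \<in> M" using z by blast
  then have "excess (insert z A) (insert y B) M = excess A B M + 1"
    using \<open>y \<notin> M\<close> excess_left[OF pos z(1), of M] excess_right[OF pos' yf, of M] by simp
  then show "to_move (insert z A) (insert y B)"
    using M by (intro lead_wins[OF position_insert(2)[OF pos' yf] M(1)])
      (simp add: odd_iff_mod_2_eq_one)
qed

text \<open>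
  Skew takes the crossing of \<open>L\<close> and \<open>M\<close>. The forced answer in \<open>L\<close> leaves
  \<open>M\<close> with positive excess, and then \<open>M\<close> and \<open>L'\<close> are crossing leads.
\<close>

lemma parallel_leads_win:
  assumes pos: "position A B"
    and L: "L \<in> \<B>" "odd (card L)" "1 \<le> excess A B L"
    and L': "L' \<in> \<B>" "odd (card L')" "1 \<le> excess A B L'"
    and M: "M \<in> \<B>" "odd (card M)" "0 \<le> excess A B M"
    and disj: "L \<inter> L' = {}"
    and x: "x \<in> free A B" "L \<inter> M = {x}"
    and x': "x' \<in> free A B" "L' \<inter> M = {x'}"
  shows "to_move A B"
proof (rule forcing_move[OF pos L(1) _ x(1)])
  show "int (card L mod 2) \<le> excess A B L" using L by (auto simp: odd_iff_mod_2_eq_one)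
  show "x \<in> L" using x by blast
  fix y assume y: "y \<in> free A B" "y \<noteq> x" "y \<in> L"
  then have ny: "y \<notin> M" "y \<notin> L'" "y \<noteq> x'" "x \<noteq> x'" using x x' disj by blast+
  have yf: "y \<in> free (insert x A) B" using y by (simp add: free_insert)
  note pos' = position_insert(1)[OF pos x(1)]
  have "x \<in> M" "x \<notin> L'" using x disj by blast+
  then have "excess (insert x A) (insert y B) M = excess A B M + 1"
    "excess (insert x A) (insert y B) L' = excess A B L'"
    using ny excess_left[OF pos x(1)] excess_right[OF pos' yf] by simp_all
  moreover have "x' \<in> free (insert x A) (insert y B)" using x'(1) ny by (simp add: free_insert)
  ultimately show "to_move (insert x A) (insert y B)"
    using L' M x'(2) by (intro crossing_leads_win[OF position_insert(2)[OF pos' yf] L'(1,2) _ M(1,2)])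
      simp_all
qed

text \<open>
  A zugzwang. While the excess of \<open>L\<close> is 1, an even number of its cells is free, so besides
  \<open>z\<close> there is another one for Skew to take, and Split has to answer in \<open>L\<close>. These exchanges use
  up \<open>L\<close> until Split must take \<open>z\<close>, which brings the excess of \<open>N\<close> down
  to at most \<open>-2\<close>.
\<close>

lemma crossing_lead_and_deficit_win:
  assumes "position A B" "even (card (free A B))"
    and L: "L \<in> \<B>" "odd (card L)" and "1 \<le> excess A B L"
    and N: "N \<in> \<B>" "odd (card N)" and "excess A B N \<le> - 1"
    and "z \<in> free A B" and z: "L \<inter> N = {z}"
  shows "to_move A B"
  using assms(1,2,5,8,9)
proof (induction "card (free A B)" arbitrary: A B rule: less_induct)
  case less
  note pos = less.prems(1)
  have L2: "card L mod 2 = 1" and N2: "card N mod 2 = 1"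
    using L N by (auto simp: odd_iff_mod_2_eq_one)
  show ?case
  proof (cases "excess A B L = 1")
    case False
    then show ?thesis using lead_wins[OF pos L(1)] less.prems L2 by simp
  next
    case True
    then have ev: "even (card (L \<inter> free A B))" using even_free_iff[OF pos L(1)] L(2) by simp
    have "L \<inter> free A B \<noteq> {z}"
    proof
      assume "L \<inter> free A B = {z}"
      with ev show False by simp
    qed
    then obtain x where x: "x \<in> free A B" "x \<in> L" "x \<noteq> z" using z less.prems(5) by blast
    then have xN: "x \<notin> N" and zN: "z \<in> N" using z by blast+
    show ?thesis
    proof (rule forcing_move[OF pos L(1) _ x(1,2)])
      show "int (card L mod 2) \<le> excess A B L" using True L2 by simp
      fix y assume y: "y \<in> free A B" "y \<noteq> x" "y \<in> L"
      have yf: "y \<in> free (insert x A) B" using y by (simp add: free_insert)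
      note pos' = position_insert(1)[OF pos x(1)]
      note pos'' = position_insert(2)[OF pos' yf]
      have card: "card (free (insert x A) (insert y B)) = card (free A B) - 2"
        using x(1) y by (simp add: free_insert finite_free)
      have ev': "even (card (free (insert x A) (insert y B)))"
        unfolding card using less.prems(2) by simp
      have N': "excess (insert x A) (insert y B) N = excess A B N - (if y \<in> N then 1 else 0)"
        using xN excess_left[OF pos x(1), of N] excess_right[OF pos' yf, of N] by simp
      show "to_move (insert x A) (insert y B)"
      proof (cases "y = z")
        case True
        then show ?thesis
          using deficit_wins[OF pos'' ev' N(1)] N' N2 less.prems(4) zN by simp
      next
        case False
        show ?thesis
        proof (rule less.hyps[OF _ pos'' ev'])
          show "card (free (insert x A) (insert y B)) < card (free A B)"
            using x(1) y by (intro psubset_card_mono finite_free) (auto simp: free_insert)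
          show "1 \<le> excess (insert x A) (insert y B) L"
            using True x y excess_left[OF pos x(1), of L] excess_right[OF pos' yf, of L] by simp
          show "excess (insert x A) (insert y B) N \<le> - 1" using N' less.prems(4) by simp
          show "z \<in> free (insert x A) (insert y B)"
            using less.prems(5) False x by (simp add: free_insert)
        qed
      qed
    qed
  qed
qed

end


section \<open>Skew on grids\<close>

locale grid_game =
  fixes m n :: nat

sublocale grid_game \<subseteq> line_game "grid m n" "grid_lines m n"
  by standard (auto simp: grid_def grid_lines_def)

context grid_game
begin

abbreviation row :: "nat \<Rightarrow> (nat \<times> nat) set" where
  "row i \<equiv> {i} \<times> {..<n}"

abbreviation col :: "nat \<Rightarrow> (nat \<times> nat) set" where
  "col j \<equiv> {..<m} \<times> {j}"

lemma row_line: "i < m \<Longrightarrow> row i \<in> grid_lines m n"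
  and col_line: "j < n \<Longrightarrow> col j \<in> grid_lines m n"
  by (auto simp: grid_lines_def)

lemma free_iff: "(i, j) \<in> free A B \<longleftrightarrow> i < m \<and> j < n \<and> (i, j) \<notin> A \<and> (i, j) \<notin> B"
  unfolding free_def by (auto simp: grid_def)

lemma position_iff:
  "position A B \<longleftrightarrow> A \<subseteq> {..<m} \<times> {..<n} \<and> B \<subseteq> {..<m} \<times> {..<n} \<and> A \<inter> B = {}"
  unfolding position_def by (simp add: grid_def)

lemma row_int_col: "i < m \<Longrightarrow> j < n \<Longrightarrow> row i \<inter> col j = {(i, j)}"
  by auto

lemma force_row:
  assumes "position A B" "(i, j) \<in> free A B" "int (n mod 2) \<le> excess A B (row i)"
    and reply: "\<And>k. \<lbrakk>(i, k) \<in> free A B; k \<noteq> j\<rbrakk> \<Longrightarrow> to_move (insert (i, j) A) (insert (i, k) B)"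
  shows "to_move A B"
proof (rule forcing_move[where L = "row i" and x = "(i, j)"])
  show "row i \<in> grid_lines m n" using assms(2) by (simp add: row_line free_iff)
  show "(i, j) \<in> row i" using assms(2) by (simp add: free_iff)
  fix y assume y: "y \<in> free A B" "y \<noteq> (i, j)" "y \<in> row i"
  then obtain k where "y = (i, k)" by auto
  then show "to_move (insert (i, j) A) (insert y B)" using y reply by simp
qed (use assms in simp_all)

lemma force_col:
  assumes "position A B" "(i, j) \<in> free A B" "int (m mod 2) \<le> excess A B (col j)"
    and reply: "\<And>k. \<lbrakk>(k, j) \<in> free A B; k \<noteq> i\<rbrakk> \<Longrightarrow> to_move (insert (i, j) A) (insert (k, j) B)"
  shows "to_move A B"
proof (rule forcing_move[where L = "col j" and x = "(i, j)"])
  show "col j \<in> grid_lines m n" using assms(2) by (simp add: col_line free_iff)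
  show "(i, j) \<in> col j" using assms(2) by (simp add: free_iff)
  fix y assume y: "y \<in> free A B" "y \<noteq> (i, j)" "y \<in> col j"
  then obtain k where "y = (k, j)" by auto
  then show "to_move (insert (i, j) A) (insert y B)" using y reply by simp
qed (use assms in simp_all)

lemma parallel_rows:
  assumes "position A B" "odd m" "odd n" "p \<noteq> q" "(p, c) \<in> free A B" "(q, c) \<in> free A B"
    and "1 \<le> excess A B (row p)" "1 \<le> excess A B (row q)" "0 \<le> excess A B (col c)"
  shows "to_move A B"
  using assms
  by (intro parallel_leads_win[where L = "row p" and L' = "row q" and M = "col c"
        and x = "(p, c)" and x' = "(q, c)"])
    (auto simp: row_line col_line free_iff)

text \<open>
  Skew takes the cells of column \<open>j\<close> one by one. In a row of nonnegative excess this forces an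
  answer in the same row, so Split never gets into the column. The exceptional row \<open>p\<close>, where Split
  may be one cell ahead after moving first, is left to the end: there the answer is not forced, but by
  then the column is complete.
\<close>

lemma fill_column:
  assumes "even n" "2 \<le> m" "j < n" "position A B"
    and "\<And>i. i < m \<Longrightarrow> (i, j) \<notin> B"
    and "\<And>i. \<lbrakk>i < m; i \<noteq> p; (i, j) \<notin> A\<rbrakk> \<Longrightarrow> 0 \<le> excess A B (row i)"
  shows "to_move A B"
  using assms(4-)
proof (induction "card {i. i < m \<and> (i, j) \<notin> A}" arbitrary: A B rule: less_induct)
  case less
  note pos = less.prems(1)
  \<comment> \<open>A column that belongs to Skew alone has excess \<open>m\<close>, which is beyond the threshold.\<close>
  have parity: "1 + int (m mod 2) \<le> int m" using \<open>2 \<le> m\<close> by (cases "m = 2") auto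
  have full: "excess A' B' (col j) = int m"
    if "\<And>i. i < m \<Longrightarrow> (i, j) \<in> A'" "position A' B'" for A' B'
  proof -
    have "A' \<inter> col j = col j" "B' \<inter> col j = {}" using that by (auto simp: position_iff)
    then show ?thesis by (simp add: excess_def)
  qed
  show ?case
  proof (cases "\<exists>i<m. (i, j) \<notin> A")
    case False
    then have "excess A B (col j) = int m" using full pos by blast
    then show ?thesis using lead_wins[OF pos col_line[OF \<open>j < n\<close>]] parity by simp
  next
    case True
    then obtain i where i: "i < m" "(i, j) \<notin> A"
      \<comment> \<open>Row \<open>p\<close> is chosen only when no other row is left.\<close>
      and ip: "i \<noteq> p \<or> (\<forall>i'<m. i' \<noteq> p \<longrightarrow> (i', j) \<in> A)" by blast
    have f: "(i, j) \<in> free A B" using i less.prems(2) \<open>j < n\<close> by (simp add: free_iff)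
    note pos' = position_insert(1)[OF pos f]
    have smaller: "card {i'. i' < m \<and> (i', j) \<notin> insert (i, j) A} < card {i'. i' < m \<and> (i', j) \<notin> A}"
      using i by (intro psubset_card_mono) auto
    show ?thesis
    proof (cases "i = p")
      case False
      show ?thesis
      proof (rule force_row[OF pos f])
        show "int (n mod 2) \<le> excess A B (row i)"
          using less.prems(3)[of i] False i \<open>even n\<close> by simp
        fix k assume k: "(i, k) \<in> free A B" "k \<noteq> j"
        then have kf: "(i, k) \<in> free (insert (i, j) A) B" by (simp add: free_iff)
        show "to_move (insert (i, j) A) (insert (i, k) B)"
        proof (rule less.hyps[OF smaller position_insert(2)[OF pos' kf]])
          fix i' assume "i' < m"
          then show "(i', j) \<notin> insert (i, k) B" using k less.prems(2) by auto
        next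
          fix i' assume "i' < m" "i' \<noteq> p" "(i', j) \<notin> insert (i, j) A"
          then show "0 \<le> excess (insert (i, j) A) (insert (i, k) B) (row i')"
            using less.prems(3)[of i'] excess_left[OF pos f, of "row i'"]
              excess_right[OF pos' kf, of "row i'"] by auto
        qed
      qed
    next
      case True
      then have all: "(i', j) \<in> insert (i, j) A" if "i' < m" for i' using ip that by blast
      show ?thesis
      proof (rule round_wins[OF f])
        assume "free A B = {(i, j)}"
        then show "to_wait (insert (i, j) A) B"
          using full_wins(2)[OF pos' col_line[OF \<open>j < n\<close>]] full[OF all pos'] parity
          by (simp add: free_insert)
      next
        fix y assume y: "y \<in> free A B - {(i, j)}"
        then have yf: "y \<in> free (insert (i, j) A) B" by (simp add: free_insert)
        note pos'' = position_insert(2)[OF pos' yf]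
        show "to_move (insert (i, j) A) (insert y B)"
          using lead_wins[OF pos'' col_line[OF \<open>j < n\<close>]] full[OF all pos''] parity by simp
      qed
    qed
  qed
qed

lemma after_first_move:
  assumes "0 < m" "0 < n" and "\<And>i j. \<lbrakk>i < m; j < n\<rbrakk> \<Longrightarrow> to_move {} {(i, j)}"
  shows "to_wait {} {}"
proof (rule wait)
  show "\<not> grid m n \<subseteq> {} \<union> {}" using assms(1,2) by (auto simp: grid_def)
  fix x assume "x \<in> grid m n - ({} \<union> {})"
  then show "to_move {} {x}" using assms(3) by (cases x) (auto simp: grid_def)
qed

lemma even_rows_win:
  assumes "even n" "2 \<le> m" "2 \<le> n"
  shows "to_move {} {}" "to_wait {} {}"
proof -
  show "to_move {} {}"
    using assms by (intro fill_column[where j = 0]) (auto simp: position_empty)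
  show "to_wait {} {}"
  proof (rule after_first_move)
    fix a b assume ab: "a < m" "b < n"
    \<comment> \<open>Any column without Split's first cell will do; the row of that cell becomes the
      exceptional one.\<close>
    define j where "j = (if b = 0 then 1 else 0 :: nat)"
    have "j < n" "j \<noteq> b" using assms by (auto simp: j_def)
    then show "to_move {} {(a, b)}"
      using assms ab
      by (intro fill_column[where j = j and p = a]) (auto simp: position_iff excess_insert)
  qed (use assms in auto)
qed

text \<open>
  After Split's \<open>(a, b)\<close> and Skew's \<open>(p, q)\<close>, row \<open>p\<close> and column \<open>q\<close>
  have excess 1 while row \<open>a\<close> and column \<open>b\<close> have excess \<open>-1\<close>. Split's second cell
  cannot lie in row \<open>p\<close> and in column \<open>q\<close> at once, so one of these keeps its excess and its
  crossing with column \<open>b\<close> or row \<open>a\<close> is still free.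
\<close>

lemma odd_second_wins:
  assumes "odd m" "odd n" "3 \<le> m" "3 \<le> n"
  shows "to_wait {} {}"
proof (rule after_first_move)
  fix a b assume ab: "a < m" "b < n"
  define p where "p = (if a = 0 then 1 else 0 :: nat)"
  define q where "q = (if b = 0 then 1 else 0 :: nat)"
  have p: "p < m" "p \<noteq> a" and q: "q < n" "q \<noteq> b" using assms by (auto simp: p_def q_def)
  have pos: "position {} {(a, b)}" and pq: "(p, q) \<in> free {} {(a, b)}"
    using ab p q by (auto simp: position_iff free_iff)
  show "to_move {} {(a, b)}"
  proof (rule round_wins[OF pq])
    assume "free {} {(a, b)} = {(p, q)}"
    moreover have "(p, b) \<in> free {} {(a, b)}" using ab p by (simp add: free_iff)
    ultimately show "to_wait {(p, q)} {(a, b)}" using q by auto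
  next
    fix y assume y: "y \<in> free {} {(a, b)} - {(p, q)}"
    obtain i j where ij: "y = (i, j)" by (cases y)
    have d: "i < m" "j < n" "(i, j) \<noteq> (a, b)" "(i, j) \<noteq> (p, q)"
      using y by (auto simp: ij free_iff)
    let ?A = "{(p, q)}" and ?B = "{(i, j), (a, b)}"
    have pos': "position ?A ?B" using d p q ab by (auto simp: position_iff)
    have "card (free ?A ?B) = card (grid m n) - card (?A \<union> ?B)"
      unfolding free_def using pos' by (intro card_Diff_subset) (auto simp: position_def)
    also have "card (?A \<union> ?B) = 3" using d p q by auto
    also have "card (grid m n) = m * n" by (simp add: grid_def)
    finally have ev: "even (card (free ?A ?B))"
      using assms(1,2) by (cases "3 \<le> m * n") auto
    show "to_move ?A (insert y {(a, b)})"
    proof (cases "i = p")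
      case True
      then have "j \<noteq> q" using d by simp
      with True show ?thesis unfolding ij using ev assms d p q ab
        by (intro crossing_lead_and_deficit_win[OF pos', where L = "col q" and N = "row a" and z = "(a, q)"])
          (auto simp: row_line col_line free_iff excess_insert)
    next
      case False
      then show ?thesis unfolding ij using ev assms d p q ab
        by (intro crossing_lead_and_deficit_win[OF pos', where L = "row p" and N = "col b" and z = "(p, b)"])
          (auto simp: row_line col_line free_iff excess_insert)
    qed
  qed
qed (use assms in auto)

lemma fresh: "length xs < k \<Longrightarrow> \<exists>c<k. c \<notin> set xs" for xs :: "nat list"
proof (rule ccontr)
  assume "length xs < k" "\<not> (\<exists>c<k. c \<notin> set xs)"
  then have "{..<k} \<subseteq> set xs" by auto
  then have "k \<le> card (set xs)" using card_mono[of "set xs" "{..<k}"] by simp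
  then show False using card_length[of xs] \<open>length xs < k\<close> by simp
qed

text \<open>
  Skew starts in a corner. Whatever Split answers, Skew continues with forcing moves that lead to two rows of
  excess 1; a column without any stones, which exists because few columns have been touched, then
  completes \<open>parallel_leads_win\<close>. Five columns are needed when Split answers in Skew's row:
  column 0, the column \<open>j\<close> of that answer, the column \<open>c\<close> with which Skew repairs row 0,
  and the column of Split's forced cell in row 1 may all be different, and a fifth must be empty.
\<close>

lemma odd_first_wins:
  assumes "odd m" "odd n" "3 \<le> m" "5 \<le> n"
  shows "to_move {} {}"
proof -
  have [simp]: "m mod 2 = 1" "n mod 2 = 1" "0 < m" "0 < n" "Suc 0 < m" "Suc 0 < n"
    using assms by (auto simp: odd_iff_mod_2_eq_one)
  note facts = position_iff free_iff excess_insert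
  have "to_move {(0, 0)} {(i, j)}" if "i < m" "j < n" "(i, j) \<noteq> (0, 0)" for i j
  proof -
    consider (row) "i = 0" "j \<noteq> 0" | (col) "i \<noteq> 0" "j = 0" | (other) "i \<noteq> 0" "j \<noteq> 0"
      using \<open>(i, j) \<noteq> (0, 0)\<close> by auto
    then show ?thesis
    proof cases
      case row
      \<comment> \<open>Row 0 is back at excess 0. Column 0 gives row 1 excess 1 with tempo; a move of row 1
        in column \<open>c\<close> then makes that column a lead, through which row 0 regains excess 1.\<close>
      show ?thesis
      proof (rule force_col[where i = 1 and j = 0])
        fix l assume l: "(l, 0) \<in> free {(0, 0)} {(i, j)}" "l \<noteq> 1"
        obtain c where c: "c < n" "c \<notin> set [0, j]"
          using fresh[of "[0, j]" n] assms by auto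
        show "to_move {(1, 0), (0, 0)} {(l, 0), (i, j)}"
        proof (rule force_row[where i = 1 and j = c])
          fix k assume k: "(1, k) \<in> free {(1, 0), (0, 0)} {(l, 0), (i, j)}" "k \<noteq> c"
          show "to_move {(1, c), (1, 0), (0, 0)} {(1, k), (l, 0), (i, j)}"
          proof (rule force_col[where i = 0 and j = c])
            fix r assume r: "(r, c) \<in> free {(1, c), (1, 0), (0, 0)} {(1, k), (l, 0), (i, j)}" "r \<noteq> 0"
            obtain d where d: "d < n" "d \<notin> set [0, j, c, k]"
              using fresh[of "[0, j, c, k]" n] assms by auto
            show "to_move {(0, c), (1, c), (1, 0), (0, 0)} {(r, c), (1, k), (l, 0), (i, j)}"
              using assms row that l c k r d
              by (intro parallel_rows[where p = 0 and q = 1 and c = d]) (auto simp: facts)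
          qed (use row that l c k in \<open>auto simp: facts\<close>)
        qed (use row that l c in \<open>auto simp: facts\<close>)
      qed (use row that in \<open>auto simp: facts\<close>)
    next
      case col
      \<comment> \<open>Row 0 is still ahead. It makes column 1 a lead, which lifts a row \<open>p\<close> that
        contains no stone of Split.\<close>
      show ?thesis
      proof (rule force_row[where i = 0 and j = 1])
        fix k assume k: "(0, k) \<in> free {(0, 0)} {(i, j)}" "k \<noteq> 1"
        obtain p where p: "p < m" "p \<notin> set [0, i]"
          using fresh[of "[0, i]" m] assms by auto
        show "to_move {(0, 1), (0, 0)} {(0, k), (i, j)}"
        proof (rule force_col[where i = p and j = 1])
          fix r assume r: "(r, 1) \<in> free {(0, 1), (0, 0)} {(0, k), (i, j)}" "r \<noteq> p"
          obtain d where d: "d < n" "d \<notin> set [0, 1, k]"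
            using fresh[of "[0, 1, k]" n] assms by auto
          show "to_move {(p, 1), (0, 1), (0, 0)} {(r, 1), (0, k), (i, j)}"
            using assms col that k p r d
            by (intro parallel_rows[where p = 0 and q = p and c = d]) (auto simp: facts)
        qed (use col that k p in \<open>auto simp: facts\<close>)
      qed (use col that in \<open>auto simp: facts\<close>)
    next
      case other
      \<comment> \<open>Row 0 and column 0 are both still ahead, and column 0 lifts a second row at once.\<close>
      obtain p where p: "p < m" "p \<notin> set [0, i]"
        using fresh[of "[0, i]" m] assms by auto
      obtain d where d: "d < n" "d \<notin> set [0, j]"
        using fresh[of "[0, j]" n] assms by auto
      show ?thesis
      proof (rule force_col[where i = p and j = 0])
        fix l assume l: "(l, 0) \<in> free {(0, 0)} {(i, j)}" "l \<noteq> p"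
        show "to_move {(p, 0), (0, 0)} {(l, 0), (i, j)}"
          using assms other that p l d
          by (intro parallel_rows[where p = 0 and q = p and c = d]) (auto simp: facts)
      qed (use other that p in \<open>auto simp: facts\<close>)
    qed
  qed
  note reply = this
  show ?thesis
  proof (rule round_wins[where x = "(0, 0)"])
    assume "free {} {} = {(0, 0)}"
    moreover have "(0, 1) \<in> free {} {}" by (simp add: free_iff)
    ultimately show "to_wait {(0, 0)} {}" by auto
  next
    fix y assume "y \<in> free {} {} - {(0, 0)}"
    then show "to_move {(0, 0)} {y}" using reply by (cases y) (auto simp: free_iff)
  qed (simp add: free_iff)
qed

end

section \<open>Transposing the grid\<close>

lemma splits_image: "inj f \<Longrightarrow> splits (f ` A) (f ` B) \<longleftrightarrow> splits A B"
  by (simp add: splits_def card_image[OF inj_on_subset[OF _ subset_UNIV]] flip: image_Int)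

lemma swap_grid_line: "L \<in> grid_lines n m \<Longrightarrow> prod.swap ` L \<in> grid_lines m n"
  unfolding grid_lines_def by (auto simp: product_swap)

lemma skew_wins_transpose:
  shows "wins_to_move (grid n m) (skewed (grid_lines n m)) {} {} \<Longrightarrow>
      wins_to_move (grid m n) (skewed (grid_lines m n)) {} {}"
    and "wins_to_wait (grid n m) (skewed (grid_lines n m)) {} {} \<Longrightarrow>
      wins_to_wait (grid m n) (skewed (grid_lines m n)) {} {}"
proof -
  have "skewed (grid_lines m n) (prod.swap ` A) (prod.swap ` B)"
    if "skewed (grid_lines n m) A B" for A B
    using that swap_grid_line splits_image[OF inj_swap] by metis
  note image = wins_image[where f = prod.swap and X = "grid n m" and G = "skewed (grid_lines n m)"
      and G' = "skewed (grid_lines m n)" and A = "{}" and B = "{}", OF _ this]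
  have swap: "prod.swap ` grid n m = grid m n" by (simp add: grid_def product_swap)
  show "wins_to_move (grid n m) (skewed (grid_lines n m)) {} {} \<Longrightarrow>
      wins_to_move (grid m n) (skewed (grid_lines m n)) {} {}"
    and "wins_to_wait (grid n m) (skewed (grid_lines n m)) {} {} \<Longrightarrow>
      wins_to_wait (grid m n) (skewed (grid_lines m n)) {} {}"
    using image by (simp_all add: swap)
qed

lemma skew_wins:
  assumes "2 \<le> m" "2 \<le> n" "\<not> (m = 3 \<and> n = 3)"
  shows "wins_to_move (grid m n) (skewed (grid_lines m n)) {} {}"
    and "wins_to_wait (grid m n) (skewed (grid_lines m n)) {} {}"
proof -
  have five: "5 \<le> k" if "odd k" "2 \<le> k" "k \<noteq> 3" for k :: nat
    using that by presburger
  consider "even n" | "even m" | "odd m" "odd n" "5 \<le> n" | "odd m" "odd n" "5 \<le> m"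
    using assms five[of m] five[of n] by auto
  then show "wins_to_move (grid m n) (skewed (grid_lines m n)) {} {}"
  proof cases
    case 1
    then show ?thesis using assms by (intro grid_game.even_rows_win)
  next
    case 2
    then show ?thesis using assms by (intro skew_wins_transpose(1)[OF grid_game.even_rows_win(1)])
  next
    case 3
    then have "3 \<le> m" using assms(1) by presburger
    with 3 show ?thesis by (intro grid_game.odd_first_wins)
  next
    case 4
    then have "3 \<le> n" using assms(2) by presburger
    with 4 show ?thesis by (intro skew_wins_transpose(1)[OF grid_game.odd_first_wins])
  qed
  consider "even n" | "even m" | "odd m" "odd n" by blast
  then show "wins_to_wait (grid m n) (skewed (grid_lines m n)) {} {}"
  proof cases
    case 1
    then show ?thesis using assms by (intro grid_game.even_rows_win)
  next
    case 2
    then show ?thesis using assms by (intro skew_wins_transpose(2)[OF grid_game.even_rows_win(2)])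
  next
    case 3
    then have "3 \<le> m" "3 \<le> n" using assms(1,2) by presburger+
    with 3 show ?thesis by (intro grid_game.odd_second_wins)
  qed
qed


section \<open>Split on the 3 by 3 grid\<close>

definition hits :: "'a list \<Rightarrow> 'a list list \<Rightarrow> bool" where
  "hits A Ls \<longleftrightarrow> list_all (list_ex (\<lambda>c. c \<in> set A)) Ls"

lemma length_remove1_twice: "x \<in> set F \<Longrightarrow> length (remove1 y (remove1 x F)) < length F"
  using length_pos_if_in_set[of x F] by (auto simp: length_remove1)

text \<open>
  Exhaustive search for the player who moves second: \<open>A\<close> holds that player's cells, \<open>B\<close> the
  opponent's, \<open>F\<close> the free cells, and the aim is that both players meet every line in \<open>Ls\<close>.
  Branches in which the opponent already owns a line are cut off, since nothing can be won there.
\<close>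

function can_answer :: "'a list list \<Rightarrow> 'a list \<Rightarrow> 'a list \<Rightarrow> 'a list \<Rightarrow> bool" where
  "can_answer Ls A B F \<longleftrightarrow>
     F = [] \<and> hits A Ls \<and> hits B Ls \<or>
     F \<noteq> [] \<and> list_all (\<lambda>x. let B' = x # B; F' = remove1 x F in
        F' = [] \<and> hits A Ls \<and> hits B' Ls \<or>
        \<not> list_ex (list_all (\<lambda>c. c \<in> set B')) Ls \<and>
          list_ex (\<lambda>y. can_answer Ls (y # A) B' (remove1 y F')) F') F"
  by auto
termination
  by (relation "measure (\<lambda>(_, _, _, F). length F)") (auto intro: length_remove1_twice)

text \<open>The defining equation is unconditional, so as a rewrite rule it would unfold without end.\<close>

declare can_answer.simps [simp del]

lemma hits_iff: "hits A Ls \<longleftrightarrow> (\<forall>L\<in>set Ls. set A \<inter> set L \<noteq> {})"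
  by (auto simp: hits_def list_all_iff list_ex_iff)

lemma can_answer_sound:
  assumes G: "\<And>A B. \<lbrakk>A \<inter> B = {}; \<forall>L\<in>set Ls. A \<inter> set L \<noteq> {} \<and> B \<inter> set L \<noteq> {}\<rbrakk> \<Longrightarrow> G A B"
  shows "\<lbrakk>can_answer Ls A B F; distinct F; set F = X - (set A \<union> set B); set A \<inter> set B = {}\<rbrakk>
    \<Longrightarrow> wins_to_wait X G (set A) (set B)"
proof (induction "length F" arbitrary: A B F rule: less_induct)
  case less
  note ca = less.prems(1)[unfolded can_answer.simps[of Ls A B F]]
  show ?case
  proof (cases "F = []")
    case True
    then have "X \<subseteq> set A \<union> set B" "G (set A) (set B)"
      using ca less.prems by (auto simp: hits_iff intro!: G)
    then show ?thesis by (rule full_to_wait)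
  next
    case False
    show ?thesis
    proof (rule wait)
      show "\<not> X \<subseteq> set A \<union> set B"
        using False less.prems(3) by (metis Diff_eq_empty_iff set_empty)
      fix x assume "x \<in> X - (set A \<union> set B)"
      then have x: "x \<in> set F" "x \<notin> set A" using less.prems(3) by auto
      let ?F = "remove1 x F"
      have F: "set ?F = X - (set A \<union> set (x # B))" "distinct ?F"
        using less.prems by (auto simp: set_remove1_eq)
      consider "?F = []" "hits A Ls" "hits (x # B) Ls"
        | y where "y \<in> set ?F" "can_answer Ls (y # A) (x # B) (remove1 y ?F)"
        using ca False x(1) by (auto simp: list_all_iff list_ex_iff Let_def)
      then have "wins_to_move X G (set A) (set (x # B))"
      proof cases
        case 1
        then show ?thesis using F x less.prems(4)
          by (intro full_to_move G) (auto simp: hits_iff)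
      next
        case 2
        have "wins_to_wait X G (set (y # A)) (set (x # B))"
        proof (rule less.hyps[OF _ 2(2)])
          show "length (remove1 y ?F) < length F"
            using x(1) by (rule length_remove1_twice)
        qed (use 2 F x less.prems in \<open>auto simp: set_remove1_eq\<close>)
        then show ?thesis using 2(1) F(1) by (intro move[of y]) auto
      qed
      then show "wins_to_move X G (set A) (insert x (set B))" by simp
    qed
  qed
qed

definition lines3 :: "(nat \<times> nat) list list" where
  "lines3 = map (\<lambda>i. map (\<lambda>j. (i, j)) [0, 1, 2]) [0, 1, 2] @
     map (\<lambda>j. map (\<lambda>i. (i, j)) [0, 1, 2]) [0, 1, 2]"

lemma lessThan_3: "{..<3::nat} = {0, 1, 2}"
  by auto

lemma grid_lines_3: "L \<in> grid_lines 3 3 \<Longrightarrow> \<exists>xs\<in>set lines3. L = set xs \<and> card (set xs) = 3"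
proof -
  assume "L \<in> grid_lines 3 3"
  then consider i where "i < 3" "L = {i} \<times> {..<3}" | j where "j < 3" "L = {..<3} \<times> {j}"
    by (auto simp: grid_lines_def)
  then show ?thesis
  proof cases
    case 1
    then have "i \<in> {0, 1, 2}" unfolding lessThan_3[symmetric] by simp
    then have "map (\<lambda>j. (i, j)) [0, 1, 2] \<in> set lines3" unfolding lines3_def by auto
    then show ?thesis using 1 by (intro bexI) (auto simp: lessThan_3)
  next
    case 2
    then have "j \<in> {0, 1, 2}" unfolding lessThan_3[symmetric] by simp
    then have "map (\<lambda>i. (i, j)) [0, 1, 2] \<in> set lines3" unfolding lines3_def by auto
    then show ?thesis using 2 by (intro bexI) (auto simp: lessThan_3)
  qed
qed

text \<open>
  A line of three cells is split as soon as each player has a cell in it. The order of the cells in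
  \<open>?F\<close> is the order in which answers are tried; this one meets good answers early and so keeps
  the search small.
\<close>

lemma split_second_wins_3:
  "wins_to_wait (grid 3 3) (\<lambda>A B. \<forall>L\<in>grid_lines 3 3. splits A L) {} {}"
proof -
  let ?F = "[(0, 1), (2, 0), (1, 0), (0, 2), (2, 2), (1, 1), (1, 2), (2, 1), (0, 0)] :: (nat \<times> nat) list"
  have "can_answer lines3 [] [] ?F" by code_simp
  moreover have "\<forall>L\<in>grid_lines 3 3. splits A L"
    if disj: "A \<inter> B = {}" and hit: "\<forall>L\<in>set lines3. A \<inter> set L \<noteq> {} \<and> B \<inter> set L \<noteq> {}" for A B
  proof
    fix L :: "(nat \<times> nat) set" assume "L \<in> grid_lines 3 3"
    then have L: "card L = 3" "A \<inter> L \<noteq> {}" "B \<inter> L \<noteq> {}" "finite L"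
      using grid_lines_3 hit by fastforce+
    then have "card ((A \<inter> L) \<union> (B \<inter> L)) \<le> 3" by (metis Int_lower2 card_mono le_sup_iff)
    moreover have "card ((A \<inter> L) \<union> (B \<inter> L)) = card (A \<inter> L) + card (B \<inter> L)"
      using L disj by (intro card_Un_disjoint) auto
    moreover have "0 < card (A \<inter> L)" "0 < card (B \<inter> L)" using L by (simp_all add: card_gt_0_iff)
    ultimately have "card (A \<inter> L) = 1 \<or> card (A \<inter> L) = 2" by linarith
    then show "splits A L" using L(1) by (auto simp: splits_def)
  qed
  moreover have "set ?F = grid 3 3" by (auto simp: grid_def lessThan_3)
  ultimately show ?thesis
    using can_answer_sound[of lines3 "\<lambda>A B. \<forall>L\<in>grid_lines 3 3. splits A L" "[]" "[]" ?F "grid 3 3"]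
    by simp
qed


section \<open>The winner of splitting tic-tac-toe\<close>

lemma skew_strategy:
  assumes "if P1 = Skew then wins_to_move X (skewed \<B>) {} {} else wins_to_wait X (skewed \<B>) {} {}"
  shows "has_winning_strategy X \<B> P1 Skew"
  by (rule has_winning_strategyI[OF assms]) (auto simp: winner_def)

theorem theorem5p7:
  fixes m n :: nat
  assumes "m \<ge> 2" and "n \<ge> 2"
  shows "(m = 3 \<and> n = 3 \<longrightarrow>
            (\<forall>P1. has_winning_strategy (grid m n) (grid_lines m n) P1 (opponent P1))) \<and>
         (\<not> (m = 3 \<and> n = 3) \<longrightarrow>
            (\<forall>P1. has_winning_strategy (grid m n) (grid_lines m n) P1 Skew))"
proof -
  have "has_winning_strategy (grid 3 3) (grid_lines 3 3) P1 (opponent P1)" for P1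
  proof (cases P1)
    case Split
    then show ?thesis by (simp add: skew_strategy grid_game.odd_second_wins)
  next
    case Skew
    have "has_winning_strategy (grid 3 3) (grid_lines 3 3) Skew Split"
      using split_second_wins_3
      by (intro has_winning_strategyI[where G = "\<lambda>A B. \<forall>L\<in>grid_lines 3 3. splits A L"])
        (auto simp: winner_def)
    then show ?thesis using Skew by simp
  qed
  moreover have "has_winning_strategy (grid m n) (grid_lines m n) P1 Skew"
    if "\<not> (m = 3 \<and> n = 3)" for P1
    using skew_wins[OF assms that] by (intro skew_strategy) simp
  ultimately show ?thesis by blast
qed

end
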